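(* Let $\rho_0,\rho_1\ge0$ be probability densities on $\mathbb{R}^d$, let $c(z)=\frac12|z|^2$, and let the standing assumption of the context hold. Then $$d(\rho_0,\rho_1)=\max_{v}\int_{\mathbb{R}^d}\big(\rho_1(x)v(x)-\rho_0(x)\phi(0,x)\big)\,dx,$$ where the maximum is over functions $v$ on $\mathbb{R}^d$ and $\phi$ is the solution of the Hamilton–Jacobi equation $$\phi_t+\frac12|\nabla\phi|^2=0\ \text{ on } [0,1]\times\mathbb{R}^d,\qquad \phi(1,x)=v(x).$$
   Context: Kantorovich distance: $d(\rho_0,\rho_1)=\inf_M\int_{\mathbb{R}^d}c(x-M(x))\rho_0(x)\,dx$, the infimum being over maps $M:\mathbb{R}^d\to\mathbb{R}^d$ with $\int_A\rho_1\,dx=\int_{\{x:\,M(x)\in A\}}\rho_0\,dx$ for all bounded (Borel) subsets $A$ of $\mathbb{R}^d$. Dual problem: maximize $\int u\rho_0\,dx+\int v\rho_1\,dy$ subject to $u(x)+v(y)\le c(x-y)$ for all $x,y$. Standing assumption (the known basic theorem on the mass transfer problem, taken as given): the dual problem has a maximizer $(\bar u,\bar v)$ consisting of dual $c$-conjugate functions, $\bar u(x)=\inf_y(c(x-y)-\bar v(y))$ and $\bar v(y)=\inf_x(c(x-y)-\bar u(x))$; and the map $\bar M$ determined by $Dc(x-\bar M(x))=\nabla\bar u(x)$ attains the infimum defining $d(\rho_0,\rho_1)$, with $d(\rho_0,\rho_1)$ equal to the maximum of the dual problem. Solution of the Hamilton–Jacobi equation: the solution with terminal value $v$ is the viscosity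 solution given by the Lax–Hopf formula $\phi(t,x)=\sup_y\{v(y)-(1-t)\,c(\tfrac{x-y}{1-t})\}$ for $0\le t<1$; in particular $\phi(0,x)=\sup_y(v(y)-c(x-y))$. The functions $v:\mathbb{R}^d\to[-\infty,\infty)$ considered are the measurable ones with $\rho_1 v$ and $\rho_0\,\phi(0,\cdot)$ integrable. *)

theory Defs
  imports "HOL-Analysis.Analysis"
begin

text \<open>
  ``Measurable'' and ``integrable'' refer to Lebesgue measure on a Euclidean space.
  Functions with values in \<open>[-\<infinity>, \<infinity>)\<close> are \<open>ereal\<close>-valued functions that avoid \<open>\<infinity>\<close>;
  the \<open>ereal\<close> convention \<open>0 * \<plusminus>\<infinity> = 0\<close> is the measure-theoretic one.
\<close>

definition cost :: "'a::euclidean_space \<Rightarrow> real" where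
  "cost z = 1/2 * (norm z)\<^sup>2"

definition prob_density :: "('a::euclidean_space \<Rightarrow> real) \<Rightarrow> bool" where
  "prob_density \<rho> \<longleftrightarrow> (\<forall>x. 0 \<le> \<rho> x) \<and> has_bochner_integral lebesgue \<rho> 1"

definition ereal_integrable :: "('a::euclidean_space \<Rightarrow> ereal) \<Rightarrow> bool" where
  "ereal_integrable f \<longleftrightarrow>
     f \<in> borel_measurable lebesgue \<and>
     (AE x in lebesgue. \<bar>f x\<bar> \<noteq> \<infinity>) \<and>
     integrable lebesgue (\<lambda>x. real_of_ereal (f x))"

definition transport_map ::
    "('a::euclidean_space \<Rightarrow> real) \<Rightarrow> ('a \<Rightarrow> real) \<Rightarrow> ('a \<Rightarrow> 'a) \<Rightarrow> bool" where
  "transport_map \<rho>0 \<rho>1 M \<longleftrightarrow>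
     M \<in> lebesgue \<rightarrow>\<^sub>M borel \<and>
     (\<forall>A\<in>sets borel. bounded A \<longrightarrow>
        (LINT x:A|lebesgue. \<rho>1 x) = (LINT x:{x. M x \<in> A}|lebesgue. \<rho>0 x))"

definition transport_cost :: "('a::euclidean_space \<Rightarrow> real) \<Rightarrow> ('a \<Rightarrow> 'a) \<Rightarrow> ereal" where
  "transport_cost \<rho>0 M = enn2ereal (\<integral>\<^sup>+x. ennreal (cost (x - M x) * \<rho>0 x) \<partial>lebesgue)"

definition kantorovich_dist ::
    "('a::euclidean_space \<Rightarrow> real) \<Rightarrow> ('a \<Rightarrow> real) \<Rightarrow> ereal" where
  "kantorovich_dist \<rho>0 \<rho>1 = (INF M\<in>{M. transport_map \<rho>0 \<rho>1 M}. transport_cost \<rho>0 M)"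

definition dual_feasible ::
    "('a::euclidean_space \<Rightarrow> real) \<Rightarrow> ('a \<Rightarrow> real) \<Rightarrow> ('a \<Rightarrow> ereal) \<Rightarrow> ('a \<Rightarrow> ereal) \<Rightarrow> bool" where
  "dual_feasible \<rho>0 \<rho>1 u v \<longleftrightarrow>
     u \<in> borel_measurable lebesgue \<and> v \<in> borel_measurable lebesgue \<and>
     (\<forall>x. u x \<noteq> \<infinity>) \<and> (\<forall>y. v y \<noteq> \<infinity>) \<and>
     ereal_integrable (\<lambda>x. ereal (\<rho>0 x) * u x) \<and>
     ereal_integrable (\<lambda>y. ereal (\<rho>1 y) * v y) \<and>
     (\<forall>x y. u x + v y \<le> ereal (cost (x - y)))"

definition dual_value ::
    "('a::euclidean_space \<Rightarrow> real) \<Rightarrow> ('a \<Rightarrow> real) \<Rightarrow> ('a \<Rightarrow> ereal) \<Rightarrow> ('a \<Rightarrow> ereal) \<Rightarrow> real" where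
  "dual_value \<rho>0 \<rho>1 u v =
     (LINT x|lebesgue. real_of_ereal (ereal (\<rho>0 x) * u x)) +
     (LINT y|lebesgue. real_of_ereal (ereal (\<rho>1 y) * v y))"

definition dual_maximizer ::
    "('a::euclidean_space \<Rightarrow> real) \<Rightarrow> ('a \<Rightarrow> real) \<Rightarrow> ('a \<Rightarrow> ereal) \<Rightarrow> ('a \<Rightarrow> ereal) \<Rightarrow> bool" where
  "dual_maximizer \<rho>0 \<rho>1 u v \<longleftrightarrow>
     dual_feasible \<rho>0 \<rho>1 u v \<and>
     (\<forall>u' v'. dual_feasible \<rho>0 \<rho>1 u' v' \<longrightarrow> dual_value \<rho>0 \<rho>1 u' v' \<le> dual_value \<rho>0 \<rho>1 u v)"

definition c_conjugate ::
    "('a::euclidean_space \<Rightarrow> ereal) \<Rightarrow> ('a \<Rightarrow> ereal) \<Rightarrow> bool" where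
  "c_conjugate u v \<longleftrightarrow>
     (\<forall>x. u x = (INF y. ereal (cost (x - y)) - v y)) \<and>
     (\<forall>y. v y = (INF x. ereal (cost (x - y)) - u x))"

text \<open>
  \<open>Dc (x - M x) = \<nabla>u x\<close>. As \<open>u\<close> is differentiable only almost everywhere (and may be
  \<open>-\<infinity>\<close> off the support of \<open>\<rho>0\<close>), the equation determines \<open>M\<close> up to \<open>\<rho>0\<close>-null sets.
\<close>
definition optimal_map_equation ::
    "('a::euclidean_space \<Rightarrow> real) \<Rightarrow> ('a \<Rightarrow> ereal) \<Rightarrow> ('a \<Rightarrow> 'a) \<Rightarrow> bool" where
  "optimal_map_equation \<rho>0 u M \<longleftrightarrow>
     (AE x in lebesgue. 0 < \<rho>0 x \<longrightarrow>
        (\<forall>\<^sub>F z in nhds x. \<bar>u z\<bar> \<noteq> \<infinity>) \<and>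
        (\<exists>g. GDERIV cost (x - M x) :> g \<and> GDERIV (\<lambda>z. real_of_ereal (u z)) x :> g))"

definition standing_assumption ::
    "('a::euclidean_space \<Rightarrow> real) \<Rightarrow> ('a \<Rightarrow> real) \<Rightarrow> bool" where
  "standing_assumption \<rho>0 \<rho>1 \<longleftrightarrow>
     (\<exists>u v M. dual_maximizer \<rho>0 \<rho>1 u v \<and> c_conjugate u v \<and>
        optimal_map_equation \<rho>0 u M \<and>
        transport_map \<rho>0 \<rho>1 M \<and> transport_cost \<rho>0 M = kantorovich_dist \<rho>0 \<rho>1 \<and>
        kantorovich_dist \<rho>0 \<rho>1 = ereal (dual_value \<rho>0 \<rho>1 u v))"

text \<open>
  The viscosity solution of \<open>\<phi>\<^sub>t + 1/2 |\<nabla>\<phi>|\<^sup>2 = 0\<close> on \<open>[0,1]\<close> with terminal value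
  \<open>\<phi>(1, x) = v x\<close>, which for arbitrary (possibly discontinuous, \<open>[-\<infinity>, \<infinity>)\<close>-valued) \<open>v\<close> is
  by convention the function given by the Lax--Hopf formula; meaningful for \<open>0 \<le> t \<le> 1\<close>.
\<close>
definition hj_solution :: "('a::euclidean_space \<Rightarrow> ereal) \<Rightarrow> real \<Rightarrow> 'a \<Rightarrow> ereal" where
  "hj_solution v t x =
     (if t = 1 then v x
      else (SUP y. v y - ereal ((1 - t) * cost ((x - y) /\<^sub>R (1 - t)))))"

lemma hj_solution_0: "hj_solution v 0 x = (SUP y. v y - ereal (cost (x - y)))"
  by (simp add: hj_solution_def)

definition hj_admissible ::
    "('a::euclidean_space \<Rightarrow> real) \<Rightarrow> ('a \<Rightarrow> real) \<Rightarrow> ('a \<Rightarrow> ereal) \<Rightarrow> bool" where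
  "hj_admissible \<rho>0 \<rho>1 v \<longleftrightarrow>
     v \<in> borel_measurable lebesgue \<and> (\<forall>x. v x \<noteq> \<infinity>) \<and>
     ereal_integrable (\<lambda>x. ereal (\<rho>1 x) * v x) \<and>
     ereal_integrable (\<lambda>x. ereal (\<rho>0 x) * hj_solution v 0 x)"

definition hj_value ::
    "('a::euclidean_space \<Rightarrow> real) \<Rightarrow> ('a \<Rightarrow> real) \<Rightarrow> ('a \<Rightarrow> ereal) \<Rightarrow> real" where
  "hj_value \<rho>0 \<rho>1 v =
     (LINT x|lebesgue. real_of_ereal (ereal (\<rho>1 x) * v x - ereal (\<rho>0 x) * hj_solution v 0 x))"

end

theory Submission
  imports Defs
begin

text \<open>
  The theorem is the dual problem with one of its two unknowns eliminated. For a fixed \<open>v\<close>,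
  the largest \<open>u\<close> satisfying \<open>u x + v y \<le> cost (x - y)\<close> is the \<open>c\<close>-transform
  \<open>INF y. cost (x - y) - v y\<close>, and the Lax--Hopf formula at time \<open>0\<close> says exactly that this
  function is \<open>-\<phi>(0, x)\<close> (\<open>hj_solution_0_eq_uminus_INF\<close>). Under \<open>u = -\<phi>(0, \<cdot>)\<close> the
  Hamilton--Jacobi functional and the dual functional coincide (\<open>hj_value_eq_dual_value\<close>).

  Hence an admissible \<open>v\<close> yields the dual feasible pair \<open>(-\<phi>(0, \<cdot>), v)\<close>
  (\<open>dual_feasible_hj_solution\<close>), and its value is at most the dual maximum, which is the
  Kantorovich distance. Conversely the maximizing pair \<open>(u, v)\<close> of the standing assumption is
  \<open>c\<close>-conjugate, so \<open>u = -\<phi>(0, \<cdot>)\<close> and \<open>v\<close> attains the maximum.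
\<close>

lemma hj_solution_0_eq_uminus_INF:
  fixes v :: "'a::euclidean_space \<Rightarrow> ereal"
  shows "hj_solution v 0 x = - (INF y. ereal (cost (x - y)) - v y)"
proof -
  have "v y - ereal (cost (x - y)) = - (ereal (cost (x - y)) - v y)" for y
    by (cases "v y") auto
  then show ?thesis
    by (simp only: hj_solution_0 ereal_SUP_uminus_eq)
qed

text \<open>
  An uncountable supremum need not be measurable, but here each function of \<open>x\<close> under the
  supremum is continuous because the cost is, so the solution at time \<open>0\<close> is lower
  semicontinuous.
\<close>
lemma borel_measurable_hj_solution_0:
  fixes v :: "'a::euclidean_space \<Rightarrow> ereal"
  shows "hj_solution v 0 \<in> borel_measurable lebesgue"
proof -
  have "open {x. a < v y - ereal (cost (x - y))}" for a y
  proof (cases "v y")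
    case (real r)
    have "continuous_on UNIV (\<lambda>x. ereal (r - cost (x - y)))"
      unfolding cost_def by (intro continuous_intros)
    then show ?thesis
      using real by (auto intro!: open_Collect_less continuous_intros)
  qed auto
  then have "open {x. a < hj_solution v 0 x}" for a
    by (auto simp: hj_solution_0 less_SUP_iff Collect_ex_eq)
  then have "hj_solution v 0 \<in> borel_measurable borel"
    by (intro borel_measurableI_greater) (auto simp: space_borel)
  then show ?thesis
    by (simp add: measurable_completion)
qed

lemma ereal_integrable_uminus:
  assumes "ereal_integrable f"
  shows "ereal_integrable (\<lambda>x. - f x)"
  using assms by (auto simp: ereal_integrable_def)

lemma integral_real_of_ereal_diff:
  assumes "ereal_integrable f" "ereal_integrable g"
  shows "(LINT x|lebesgue. real_of_ereal (f x - g x)) =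
         (LINT x|lebesgue. real_of_ereal (f x)) - (LINT x|lebesgue. real_of_ereal (g x))"
proof -
  have [measurable]: "f \<in> borel_measurable lebesgue" "g \<in> borel_measurable lebesgue"
    using assms by (auto simp: ereal_integrable_def)
  have fin: "AE x in lebesgue. \<bar>f x\<bar> \<noteq> \<infinity>" "AE x in lebesgue. \<bar>g x\<bar> \<noteq> \<infinity>"
    using assms by (auto simp: ereal_integrable_def)
  have "(LINT x|lebesgue. real_of_ereal (f x - g x)) =
        (LINT x|lebesgue. real_of_ereal (f x) - real_of_ereal (g x))"
  proof (rule integral_cong_AE)
    show "AE x in lebesgue. real_of_ereal (f x - g x) = real_of_ereal (f x) - real_of_ereal (g x)"
      using fin by eventually_elim (auto simp: real_of_ereal_minus)
  qed measurable
  also have "\<dots> = (LINT x|lebesgue. real_of_ereal (f x)) - (LINT x|lebesgue. real_of_ereal (g x))"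
    using assms by (intro Bochner_Integration.integral_diff) (auto simp: ereal_integrable_def)
  finally show ?thesis .
qed

lemma hj_value_eq_dual_value:
  assumes "hj_admissible \<rho>0 \<rho>1 v"
  shows "hj_value \<rho>0 \<rho>1 v = dual_value \<rho>0 \<rho>1 (\<lambda>x. - hj_solution v 0 x) v"
  using assms
  by (simp add: hj_admissible_def hj_value_def dual_value_def integral_real_of_ereal_diff)

text \<open>
  The delicate point is that \<open>-\<phi>(0, \<cdot>)\<close> must avoid \<open>\<infinity>\<close>. Finiteness of \<open>\<phi>(0, \<cdot>)\<close> at a
  single point already suffices, since it forces \<open>v\<close> to be finite somewhere and hence
  \<open>\<phi>(0, \<cdot>)\<close> above \<open>-\<infinity>\<close> everywhere; such a point exists because \<open>\<rho>0\<close> has mass \<open>1\<close>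
  and \<open>\<phi>(0, \<cdot>)\<close> is finite almost everywhere on \<open>{x. \<rho>0 x > 0}\<close>.
\<close>
lemma hj_solution_0_neq_MInf:
  assumes "prob_density \<rho>0" "hj_admissible \<rho>0 \<rho>1 v"
  shows "hj_solution v 0 x \<noteq> - \<infinity>"
proof
  assume "hj_solution v 0 x = - \<infinity>"
  then have le: "v y - ereal (cost (x - y)) \<le> - \<infinity>" for y
    unfolding hj_solution_0 by (simp add: bot_ereal_def[symmetric])
  have "v y = - \<infinity>" for y
    using le[of y] by (cases "v y") auto
  then have phi: "hj_solution v 0 z = - \<infinity>" for z
    by (simp add: hj_solution_0)
  have "AE z in lebesgue. \<bar>ereal (\<rho>0 z) * hj_solution v 0 z\<bar> \<noteq> \<infinity>"
    using assms(2) by (simp add: hj_admissible_def ereal_integrable_def)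
  then have "AE z in lebesgue. \<rho>0 z = 0"
    by eventually_elim (auto simp: phi split: if_splits)
  then have "(LINT z|lebesgue. \<rho>0 z) = 0"
    by (rule integral_eq_zero_AE)
  then show False
    using assms(1) by (auto simp: prob_density_def has_bochner_integral_iff)
qed

lemma dual_feasible_hj_solution:
  assumes "prob_density \<rho>0" "hj_admissible \<rho>0 \<rho>1 v"
  shows "dual_feasible \<rho>0 \<rho>1 (\<lambda>x. - hj_solution v 0 x) v"
proof -
  have v: "v y \<noteq> \<infinity>" for y
    using assms(2) by (simp add: hj_admissible_def)
  have phi: "hj_solution v 0 x \<noteq> - \<infinity>" for x
    using hj_solution_0_neq_MInf[OF assms] .
  have "- hj_solution v 0 x + v y \<le> ereal (cost (x - y))" for x y
  proof -
    have "v y - ereal (cost (x - y)) \<le> hj_solution v 0 x"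
      unfolding hj_solution_0 by (rule SUP_upper) simp
    then show ?thesis
      using v[of y] phi[of x] by (cases "v y"; cases "hj_solution v 0 x") auto
  qed
  moreover have "- hj_solution v 0 x \<noteq> \<infinity>" for x
    using phi[of x] by (simp add: ereal_uminus_eq_reorder)
  ultimately show ?thesis
    using assms(2) borel_measurable_hj_solution_0[of v]
    by (auto simp: dual_feasible_def hj_admissible_def intro: ereal_integrable_uminus)
qed

theorem mainTheorem2:
  fixes \<rho>0 \<rho>1 :: "'a::euclidean_space \<Rightarrow> real"
  assumes "prob_density \<rho>0"
    and "prob_density \<rho>1"
    and "standing_assumption \<rho>0 \<rho>1"
  shows "(\<exists>v. hj_admissible \<rho>0 \<rho>1 v \<and> kantorovich_dist \<rho>0 \<rho>1 = ereal (hj_value \<rho>0 \<rho>1 v)) \<and>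
         (\<forall>v. hj_admissible \<rho>0 \<rho>1 v \<longrightarrow> ereal (hj_value \<rho>0 \<rho>1 v) \<le> kantorovich_dist \<rho>0 \<rho>1)"
proof -
  obtain u v where max: "dual_maximizer \<rho>0 \<rho>1 u v" and conj: "c_conjugate u v"
    and d: "kantorovich_dist \<rho>0 \<rho>1 = ereal (dual_value \<rho>0 \<rho>1 u v)"
    using assms(3) by (auto simp: standing_assumption_def)
  have feas: "dual_feasible \<rho>0 \<rho>1 u v"
    using max by (simp add: dual_maximizer_def)
  have phi: "hj_solution v 0 x = - u x" for x
    using conj unfolding hj_solution_0_eq_uminus_INF c_conjugate_def by metis
  have adm: "hj_admissible \<rho>0 \<rho>1 v"
    using feas ereal_integrable_uminus[of "\<lambda>x. ereal (\<rho>0 x) * u x"]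
    by (auto simp: hj_admissible_def dual_feasible_def phi)
  have "kantorovich_dist \<rho>0 \<rho>1 = ereal (hj_value \<rho>0 \<rho>1 v)"
    using hj_value_eq_dual_value[OF adm] by (simp add: d phi)
  moreover have "ereal (hj_value \<rho>0 \<rho>1 w) \<le> kantorovich_dist \<rho>0 \<rho>1"
    if w: "hj_admissible \<rho>0 \<rho>1 w" for w
    using max dual_feasible_hj_solution[OF assms(1) w]
    by (simp add: d hj_value_eq_dual_value[OF w] dual_maximizer_def)
  ultimately show ?thesis
    using adm by blast
qed

end
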